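(* Let $P_0\in\mathcal{P}(\mathcal{H})$. The action of $\mathcal{U}(\mathcal{H})$ on $\mathcal{R}_{P_0}$, $U\cdot(P,f)=(UPU^*,Uf)$, is transitive. If $f_0\in R(P_0)$ with $\|f_0\|=1$, then the map $$\rho_{(P_0,f_0)}:\mathcal{U}(\mathcal{H})\to\mathcal{R}_{P_0},\qquad \rho_{(P_0,f_0)}(U)=(UP_0U^*,Uf_0),$$ has continuous local cross sections.
   Context: $\mathcal{H}$ is a complex Hilbert space, $\mathcal{B}(\mathcal{H})$ the algebra of bounded operators with the operator norm, $\mathcal{U}(\mathcal{H})$ the unitary group with the norm topology, $\mathcal{P}(\mathcal{H})$ the set of orthogonal projections on $\mathcal{H}$. $R(\cdot)$ denotes the range. Let $\mathcal{R}=\{(P,f)\in\mathcal{P}(\mathcal{H})\times\mathcal{H}: Pf=f,\ \|f\|=1\}$ with the topology inherited from $\mathcal{B}(\mathcal{H})\times\mathcal{H}$, and $\mathcal{R}_{P_0}=\{(P,f)\in\mathcal{R}: P=WP_0W^* \text{ for some } W\in\mathcal{U}(\mathcal{H})\}$. Having continuous local cross sections means that every point of $\mathcal{R}_{P_0}$ has an open neighbourhood $\mathcal{V}$ in $\mathcal{R}_{P_0}$ and a continuous map $\sigma:\mathcal{V}\to\mathcal{U}(\mathcal{H})$ with $\rho_{(P_0,f_0)}\circ\sigma=\mathrm{id}_{\mathcal{V}}$. *)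

theory Defs
  imports "HOL-Analysis.Analysis" "HOL-Algebra.Group_Action"
begin

section \<open>Complex Hilbert spaces\<close>

text \<open>
  The scalar product is linear in the first argument. The norm, the metric and completeness come
  from the underlying real Hilbert space, whose scalar product is the real part of the complex one;
  positive definiteness of the complex scalar product follows, see \<open>cinner_self\<close>.
  The dimension is arbitrary (the zero space and non-separable spaces are included).
\<close>

class complex_hilbert_space = real_inner + complete_space +
  fixes scaleC :: "complex \<Rightarrow> 'a \<Rightarrow> 'a"  (infixr \<open>*\<^sub>C\<close> 75)
    and cinner :: "'a \<Rightarrow> 'a \<Rightarrow> complex"
  assumes scaleC_add_right: "a *\<^sub>C (x + y) = a *\<^sub>C x + a *\<^sub>C y"
    and scaleC_add_left: "(a + b) *\<^sub>C x = a *\<^sub>C x + b *\<^sub>C x"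
    and scaleC_scaleC: "a *\<^sub>C (b *\<^sub>C x) = (a * b) *\<^sub>C x"
    and scaleC_of_real: "complex_of_real r *\<^sub>C x = r *\<^sub>R x"
    and cinner_commute: "cinner x y = cnj (cinner y x)"
    and cinner_add_left: "cinner (x + y) z = cinner x z + cinner y z"
    and cinner_scaleC_left: "cinner (a *\<^sub>C x) y = a * cinner x y"
    and inner_eq_Re_cinner: "inner x y = Re (cinner x y)"

lemma cinner_self: "cinner x x = complex_of_real ((norm x)\<^sup>2)"
proof -
  have "Im (cinner x x) = 0"
    by (metis cinner_commute cnj.sel(2) equal_neg_zero)
  moreover have "Re (cinner x x) = (norm x)\<^sup>2"
    by (simp add: inner_eq_Re_cinner[symmetric] power2_norm_eq_inner)
  ultimately show ?thesis
    by (simp add: complex_eq_iff)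
qed

lemma Im_cinner: "Im (cinner x y) = inner (- \<i> *\<^sub>C x) y"
  by (simp add: inner_eq_Re_cinner cinner_scaleC_left)

instantiation complex :: complex_hilbert_space
begin

definition scaleC_complex :: "complex \<Rightarrow> complex \<Rightarrow> complex"
  where "scaleC_complex a z = a * z"

definition cinner_complex :: "complex \<Rightarrow> complex \<Rightarrow> complex"
  where "cinner_complex z w = z * cnj w"

instance
  by standard
    (auto simp: scaleC_complex_def cinner_complex_def algebra_simps scaleR_conv_of_real
      inner_complex_def)

end


section \<open>Bounded operators, adjoints, unitaries and projections\<close>

text \<open>
  \<open>\<B>(\<H>)\<close> is a subset of the type \<open>'a \<Rightarrow>\<^sub>L 'a\<close> of bounded real-linear maps. The norm of that type
  is the usual operator norm, so \<open>\<B>(\<H>)\<close> and its subsets carry the norm topology as subspaces.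
\<close>

definition bounded_ops :: "('a::complex_hilbert_space \<Rightarrow>\<^sub>L 'a) set"
  where "bounded_ops = {T. \<forall>a x. blinfun_apply T (a *\<^sub>C x) = a *\<^sub>C blinfun_apply T x}"

definition adj :: "('a::complex_hilbert_space \<Rightarrow>\<^sub>L 'a) \<Rightarrow> ('a \<Rightarrow>\<^sub>L 'a)"
  where "adj T = (THE S. S \<in> bounded_ops \<and> (\<forall>x y. cinner (T x) y = cinner x (blinfun_apply S y)))"

definition unitary_ops :: "('a::complex_hilbert_space \<Rightarrow>\<^sub>L 'a) set"
  where "unitary_ops =
    {U \<in> bounded_ops. adj U o\<^sub>L U = id_blinfun \<and> U o\<^sub>L adj U = id_blinfun}"

definition unitary_group :: "('a::complex_hilbert_space \<Rightarrow>\<^sub>L 'a) monoid"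
  where "unitary_group = \<lparr>carrier = unitary_ops, mult = (o\<^sub>L), one = id_blinfun\<rparr>"

definition projections :: "('a::complex_hilbert_space \<Rightarrow>\<^sub>L 'a) set"
  where "projections = {P \<in> bounded_ops. P o\<^sub>L P = P \<and> adj P = P}"


subsection \<open>The adjoint of an operator in \<open>\<B>(\<H>)\<close> exists\<close>

lemma riesz_representation_real:
  fixes f :: "'a::{real_inner,complete_space} \<Rightarrow> real"
  assumes "bounded_linear f"
  shows "\<exists>z. \<forall>x. f x = inner x z"
proof -
  interpret f: bounded_linear f by fact
  define J where "J x = inner x x - 2 * f x" for x
  define m where "m = (INF x. J x)"
  obtain K where K: "\<And>x. norm (f x) \<le> norm x * K"
    using f.bounded by blast
  have low: "- (K\<^sup>2) \<le> J x" for x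
  proof -
    have "f x \<le> norm x * K" using K[of x] by simp
    moreover have "0 \<le> (norm x - K)\<^sup>2" by simp
    ultimately show ?thesis
      unfolding J_def power2_norm_eq_inner[symmetric] by (simp add: power2_diff)
  qed
  have bdd: "bdd_below (range J)" using low by (intro bdd_belowI2)
  have mle: "m \<le> J x" for x unfolding m_def by (rule cINF_lower[OF bdd]) simp
  have "\<exists>x. J x < m + 1 / Suc n" for n :: nat
    using cInf_lessD[of "range J" "m + 1 / Suc n"] by (auto simp: m_def)
  then obtain X where X: "\<And>n::nat. J (X n) < m + 1 / Suc n" by metis
  have par: "(norm (x - y))\<^sup>2 = 2 * J x + 2 * J y - 4 * J ((1/2) *\<^sub>R (x + y))" for x y
    unfolding J_def power2_norm_eq_inner
    by (simp add: algebra_simps f.add f.scaleR inner_commute)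
  have "Cauchy X"
  proof (rule metric_CauchyI)
    fix e :: real assume "0 < e"
    then obtain N :: nat where N: "4 / e\<^sup>2 < real N"
      using reals_Archimedean2 by blast
    then have N': "4 / Suc N < e\<^sup>2"
      using \<open>0 < e\<close> by (simp add: field_simps) (smt (verit) zero_less_power)
    show "\<exists>M. \<forall>p\<ge>M. \<forall>q\<ge>M. dist (X p) (X q) < e"
    proof (intro exI allI impI)
      fix p q assume pq: "N \<le> p" "N \<le> q"
      have "1 / Suc p \<le> 1 / Suc N" "1 / Suc q \<le> 1 / Suc N"
        using pq by (auto intro!: divide_left_mono)
      then have "(norm (X p - X q))\<^sup>2 < 4 / Suc N"
        using par[of "X p" "X q"] X[of p] X[of q] mle[of "(1/2) *\<^sub>R (X p + X q)"] by simp
      with N' have "(norm (X p - X q))\<^sup>2 < e\<^sup>2" by linarith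
      then show "dist (X p) (X q) < e"
        using \<open>0 < e\<close> by (simp add: dist_norm power_less_imp_less_base)
    qed
  qed
  then obtain z where z: "X \<longlonglongrightarrow> z"
    using Cauchy_convergent convergent_def by blast
  have "(\<lambda>n. J (X n)) \<longlonglongrightarrow> J z"
    unfolding J_def by (intro tendsto_intros f.tendsto z)
  moreover have "(\<lambda>n. m + 1 / Suc n) \<longlonglongrightarrow> m + 0"
    using LIMSEQ_inverse_real_of_nat by (intro tendsto_intros) (simp add: inverse_eq_divide)
  ultimately have "J z \<le> m + 0"
    by (rule LIMSEQ_le) (use X in \<open>auto intro: less_imp_le\<close>)
  then have min: "J z \<le> J x" for x using mle[of x] by simp
  have "f x = inner x z" for x
  proof -
    define d where "d = f x - inner x z"
    have *: "2 * t * d \<le> t\<^sup>2 * inner x x" for t :: real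
      using min[of "z + t *\<^sub>R x"] unfolding J_def d_def
      by (simp add: f.add f.scaleR algebra_simps inner_commute power2_eq_square)
    define c where "c = inner x x + 1"
    have c: "0 < c" "inner x x \<le> c" by (auto simp: c_def add_nonneg_pos)
    have "2 * (d / c) * d \<le> (d / c)\<^sup>2 * c"
      by (rule order_trans[OF *]) (intro mult_left_mono c, simp)
    then have "d\<^sup>2 \<le> 0"
      using c by (simp add: field_simps power2_eq_square)
    then show ?thesis by (simp add: d_def)
  qed
  then show ?thesis by blast
qed

lemma cinner_eqI:
  fixes y y' :: "'a::complex_hilbert_space"
  assumes "\<And>x. cinner x y = cinner x y'"
  shows "y = y'"
proof -
  have "inner (y - y') (y - y') = 0"
    using assms[of "y - y'"] by (metis diff_self inner_diff_right inner_eq_Re_cinner)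
  then show ?thesis by simp
qed

lemma adj_exists:
  fixes T :: "'a::complex_hilbert_space \<Rightarrow>\<^sub>L 'a"
  assumes "T \<in> bounded_ops"
  shows "\<exists>!S. S \<in> bounded_ops \<and> (\<forall>x y. cinner (T x) y = cinner x (blinfun_apply S y))"
proof -
  have "\<exists>z. \<forall>x. inner (T x) y = inner x z" for y
    by (rule riesz_representation_real)
      (intro bounded_linear_compose[OF bounded_linear_inner_left] blinfun.bounded_linear_right)
  then obtain g where g: "\<And>x y. inner (T x) y = inner x (g y)" by metis
  have g': "cinner (T x) y = cinner x (g y)" for x y
  proof (rule complex_eqI)
    show "Re (cinner (T x) y) = Re (cinner x (g y))"
      using g by (simp add: inner_eq_Re_cinner)
    have "- \<i> *\<^sub>C T x = T (- \<i> *\<^sub>C x)"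
      using assms by (simp add: bounded_ops_def)
    then show "Im (cinner (T x) y) = Im (cinner x (g y))"
      using g by (simp add: Im_cinner)
  qed
  have scaleC_right: "cinner x (a *\<^sub>C y) = cnj a * cinner x y" for a and x y :: 'a
    by (metis cinner_commute cinner_scaleC_left complex_cnj_mult)
  have gC: "g (a *\<^sub>C y) = a *\<^sub>C g y" for a y
    by (rule cinner_eqI) (simp add: g'[symmetric] scaleC_right)
  have add_right: "cinner x (y + z) = cinner x y + cinner x z" for x y z :: 'a
    by (metis cinner_commute cinner_add_left complex_cnj_add)
  have "bounded_linear g"
  proof (rule bounded_linear_intro)
    show "g (x + y) = g x + g y" for x y
      by (rule cinner_eqI) (simp add: g'[symmetric] add_right)
    show "g (r *\<^sub>R x) = r *\<^sub>R g x" for r x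
      using gC[of "of_real r" x] by (simp add: scaleC_of_real)
    show "norm (g y) \<le> norm y * norm T" for y
    proof (cases "g y = 0")
      case False
      have "norm (g y) * norm (g y) = inner (T (g y)) y"
        by (simp add: g power2_norm_eq_inner[symmetric] power2_eq_square)
      also have "\<dots> \<le> norm (T (g y)) * norm y" by (rule norm_cauchy_schwarz)
      also have "\<dots> \<le> norm T * norm (g y) * norm y"
        by (intro mult_right_mono norm_blinfun) simp
      finally show ?thesis using False by (simp add: mult.commute mult.left_commute)
    qed simp
  qed
  then have S: "blinfun_apply (Blinfun g) = g" by (rule bounded_linear_Blinfun_apply)
  show ?thesis
  proof (rule ex1I[of _ "Blinfun g"])
    show "Blinfun g \<in> bounded_ops \<and> (\<forall>x y. cinner (T x) y = cinner x (Blinfun g y))"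
      using g' gC by (simp add: S bounded_ops_def)
    show "S = Blinfun g"
      if "S \<in> bounded_ops \<and> (\<forall>x y. cinner (T x) y = cinner x (blinfun_apply S y))" for S
      by (rule blinfun_eqI, rule cinner_eqI) (use that g' in \<open>simp add: S\<close>)
  qed
qed

lemma
  fixes T :: "'a::complex_hilbert_space \<Rightarrow>\<^sub>L 'a"
  assumes "T \<in> bounded_ops"
  shows adj_in_bounded_ops: "adj T \<in> bounded_ops"
    and cinner_adj: "cinner (T x) y = cinner x (adj T y)"
  using theI'[OF adj_exists[OF assms]] unfolding adj_def by blast+


section \<open>The space \<open>\<R>\<^sub>P\<^sub>0\<close>, the action and local cross sections\<close>

definition proj_vec :: "(('a::complex_hilbert_space \<Rightarrow>\<^sub>L 'a) \<times> 'a) set"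
  where "proj_vec = {(P, f). P \<in> projections \<and> blinfun_apply P f = f \<and> norm f = 1}"

definition proj_vec_orbit ::
    "('a::complex_hilbert_space \<Rightarrow>\<^sub>L 'a) \<Rightarrow> (('a \<Rightarrow>\<^sub>L 'a) \<times> 'a) set"
  where "proj_vec_orbit P\<^sub>0 =
    {(P, f) \<in> proj_vec. \<exists>W \<in> unitary_ops. P = W o\<^sub>L P\<^sub>0 o\<^sub>L adj W}"

definition unitary_act ::
    "('a::complex_hilbert_space \<Rightarrow>\<^sub>L 'a) \<Rightarrow> ('a \<Rightarrow>\<^sub>L 'a) \<times> 'a \<Rightarrow> ('a \<Rightarrow>\<^sub>L 'a) \<times> 'a"
  where "unitary_act U = (\<lambda>(P, f). (U o\<^sub>L P o\<^sub>L adj U, blinfun_apply U f))"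

definition rho ::
    "('a::complex_hilbert_space \<Rightarrow>\<^sub>L 'a) \<times> 'a \<Rightarrow> ('a \<Rightarrow>\<^sub>L 'a) \<Rightarrow> ('a \<Rightarrow>\<^sub>L 'a) \<times> 'a"
  where "rho = (\<lambda>(P\<^sub>0, f\<^sub>0) U. (U o\<^sub>L P\<^sub>0 o\<^sub>L adj U, blinfun_apply U f\<^sub>0))"

definition has_continuous_local_cross_sections ::
    "'e::topological_space set \<Rightarrow> 'b::topological_space set \<Rightarrow> ('e \<Rightarrow> 'b) \<Rightarrow> bool"
  where "has_continuous_local_cross_sections E B p \<longleftrightarrow>
    (\<forall>b \<in> B. \<exists>V \<sigma>. openin (top_of_set B) V \<and> b \<in> V \<and>
      continuous_on V \<sigma> \<and> \<sigma> \<in> V \<rightarrow> E \<and> (\<forall>v \<in> V. p (\<sigma> v) = v))"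

end

theory Submission
  imports Defs
begin

text \<open>
  The whole proof rests on two explicit families of unitaries, both continuous in the norm topology.

  The first family moves vectors. For \<open>f\<close>, \<open>g\<close> of equal norm with \<open>u = f + g \<noteq> 0\<close>, the operator
  \<open>x \<mapsto> (\<langle>x, u\<rangle> / \<langle>f, u\<rangle>) u - x\<close> (\<open>carry f g\<close>) is unitary and sends \<open>f\<close> to \<open>g\<close>. It is the complex
  analogue of the reflection in the bisector of \<open>f\<close> and \<open>g\<close>. Up to the summand \<open>-1\<close> it is a multiple
  of the orthogonal projection onto the line through \<open>u\<close>, so it commutes with every projection whose range contains \<open>f\<close> and \<open>g\<close>.

  The second family moves projections. For projections with \<open>\<parallel>P - Q\<parallel> \<le> 1/2\<close> put
  \<open>Z = PQ + (1 - P)(1 - Q)\<close>. Then \<open>PZ = PQ = ZQ\<close> and \<open>Z\<^sup>*Z = ZZ\<^sup>* = 1 - E\<close> with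
  \<open>E = (P - Q)\<^sup>2\<close>, which commutes with \<open>P\<close> and \<open>Q\<close>. Hence \<open>S = Z (1 - E)\<^sup>-\<^sup>1\<^sup>/\<^sup>2\<close>
  (\<open>direct_rotation Q P\<close>) is unitary and \<open>S Q S\<^sup>* = P\<close>. The inverse square root is the fixed point of
  a contraction, which yields its commutation properties, its symmetry and its Lipschitz dependence on
  \<open>E\<close> without functional calculus.

  Transitivity (\<open>orbit_transitive\<close>): given \<open>(P, f)\<close> and \<open>(Q, g)\<close> in the orbit, some unitary \<open>W\<close>
  conjugates \<open>P\<close> to \<open>Q\<close>; then a unitary that commutes with \<open>Q\<close> corrects \<open>W f\<close> to \<open>g\<close>.

  Local sections (\<open>local_section_at\<close>): near \<open>(P\<^sub>1, f\<^sub>1)\<close> the point \<open>(P, f)\<close> is reached by the direct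
  rotation \<open>S\<close> from \<open>P\<^sub>1\<close> to \<open>P\<close>, followed by \<open>carry (S f\<^sub>1) f\<close>. By transitivity
  \<open>(P\<^sub>1, f\<^sub>1)\<close> is the image of the base point under some \<open>W\<close>, and multiplying on the right by \<open>W\<close>
  gives the required section.
\<close>

subclass (in complex_hilbert_space) banach ..

section \<open>Adjoints and unitaries\<close>

lemma cinner_add_right: "cinner x (y + z) = cinner x y + cinner x z"
  for x y z :: "'a::complex_hilbert_space"
  by (metis cinner_commute cinner_add_left complex_cnj_add)

lemma cinner_scaleC_right: "cinner x (a *\<^sub>C y) = cnj a * cinner x y"
  for x y :: "'a::complex_hilbert_space"
  by (metis cinner_commute cinner_scaleC_left complex_cnj_mult)

lemma cinner_minus_left: "cinner (- x) y = - cinner x y"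
  for x y :: "'a::complex_hilbert_space"
  using cinner_scaleC_left[of "complex_of_real (-1)" x y] by (simp only: scaleC_of_real) simp

lemma cinner_diff_left: "cinner (x - y) z = cinner x z - cinner y z"
  for x y z :: "'a::complex_hilbert_space"
  by (metis cinner_add_left cinner_minus_left diff_conv_add_uminus)

lemma scaleC_Re_Im: "a *\<^sub>C x = Re a *\<^sub>R x + Im a *\<^sub>R (\<i> *\<^sub>C x)"
  for x :: "'a::complex_hilbert_space"
proof -
  have "a = complex_of_real (Re a) + complex_of_real (Im a) * \<i>"
    by (simp add: complex_eq_iff)
  then have "a *\<^sub>C x = (complex_of_real (Re a) + complex_of_real (Im a) * \<i>) *\<^sub>C x"
    by (rule arg_cong)
  also have "\<dots> = Re a *\<^sub>R x + Im a *\<^sub>R (\<i> *\<^sub>C x)"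
    by (simp only: scaleC_add_left scaleC_scaleC[symmetric] scaleC_of_real)
  finally show ?thesis .
qed

lemma scaleC_minus_right: "a *\<^sub>C (- x) = - (a *\<^sub>C x)"
  for x :: "'a::complex_hilbert_space"
  by (metis add.right_inverse add_cancel_right_left minus_unique scaleC_add_right)

lemma scaleC_diff_right: "a *\<^sub>C (x - y) = a *\<^sub>C x - a *\<^sub>C y"
  for x y :: "'a::complex_hilbert_space"
  by (metis diff_conv_add_uminus scaleC_add_right scaleC_minus_right)

lemma norm_scaleC_imaginary_unit: "norm (\<i> *\<^sub>C x) = norm x" for x :: "'a::complex_hilbert_space"
proof -
  have "(norm (\<i> *\<^sub>C x))\<^sup>2 = (norm x)\<^sup>2"
    by (simp add: power2_norm_eq_inner inner_eq_Re_cinner cinner_scaleC_left cinner_scaleC_right)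
  then show ?thesis by simp
qed

definition imult :: "'a::complex_hilbert_space \<Rightarrow>\<^sub>L 'a"
  where "imult = Blinfun (\<lambda>x. \<i> *\<^sub>C x)"

lemma imult_apply [simp]: "blinfun_apply imult x = \<i> *\<^sub>C x"
proof -
  have "bounded_linear (\<lambda>x::'a. \<i> *\<^sub>C x)"
  proof (rule bounded_linear_intro)
    show "\<i> *\<^sub>C (r *\<^sub>R x) = r *\<^sub>R (\<i> *\<^sub>C x)" for r and x :: 'a
      by (metis scaleC_of_real scaleC_scaleC mult.commute)
    show "norm (\<i> *\<^sub>C x) \<le> norm x * 1" for x :: 'a
      by (simp add: norm_scaleC_imaginary_unit)
  qed (rule scaleC_add_right)
  then show ?thesis by (simp add: imult_def bounded_linear_Blinfun_apply)
qed

text \<open>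
  Complex linearity becomes a commutation relation. A real operator that commutes with everything in
  the commutant of a complex-linear one is therefore itself complex-linear; this is how the inverse
  square root below is seen to be complex-linear.
\<close>

lemma bounded_ops_iff_commute_imult: "T \<in> bounded_ops \<longleftrightarrow> imult o\<^sub>L T = T o\<^sub>L imult"
proof
  assume "T \<in> bounded_ops"
  then show "imult o\<^sub>L T = T o\<^sub>L imult"
    by (intro blinfun_eqI) (simp add: bounded_ops_def)
next
  assume "imult o\<^sub>L T = T o\<^sub>L imult"
  then have "T (\<i> *\<^sub>C x) = \<i> *\<^sub>C T x" for x
    by (metis blinfun_apply_blinfun_compose imult_apply)
  then have "T (a *\<^sub>C x) = a *\<^sub>C T x" for a x
    by (subst (1 2) scaleC_Re_Im) (simp add: blinfun.bilinear_simps)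
  then show "T \<in> bounded_ops"
    by (simp add: bounded_ops_def)
qed

lemma bounded_opsD: "T \<in> bounded_ops \<Longrightarrow> blinfun_apply T (a *\<^sub>C x) = a *\<^sub>C blinfun_apply T x"
  by (simp add: bounded_ops_def)

lemma id_in_bounded_ops [simp]: "id_blinfun \<in> bounded_ops"
  by (simp add: bounded_ops_def)

lemma compose_in_bounded_ops: "A \<in> bounded_ops \<Longrightarrow> B \<in> bounded_ops \<Longrightarrow> A o\<^sub>L B \<in> bounded_ops"
  by (simp add: bounded_ops_def)

lemma add_in_bounded_ops: "A \<in> bounded_ops \<Longrightarrow> B \<in> bounded_ops \<Longrightarrow> A + B \<in> bounded_ops"
  by (simp add: bounded_ops_def blinfun.bilinear_simps scaleC_add_right)

lemma diff_in_bounded_ops: "A \<in> bounded_ops \<Longrightarrow> B \<in> bounded_ops \<Longrightarrow> A - B \<in> bounded_ops"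
  by (simp add: bounded_ops_def blinfun.bilinear_simps scaleC_diff_right)

text \<open>
  For complex-linear operators the real scalar product already determines the adjoint, so
  adjoints can be verified inside the underlying real Hilbert space.
\<close>

lemma inner_adj:
  assumes "T \<in> bounded_ops"
  shows "inner (blinfun_apply T x) y = inner x (blinfun_apply (adj T) y)"
  using cinner_adj[OF assms] by (simp add: inner_eq_Re_cinner)

lemma adj_eqI:
  assumes "T \<in> bounded_ops" "\<And>x y. inner (blinfun_apply T x) y = inner x (blinfun_apply S y)"
  shows "adj T = S"
proof (rule blinfun_eqI)
  fix y
  have "\<forall>x. inner x (adj T y - S y) = 0"
    using assms(2) inner_adj[OF assms(1)] by (simp add: inner_diff_right)
  then have "inner (adj T y - S y) (adj T y - S y) = 0" by blast
  then show "adj T y = S y" by simp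
qed

lemma adj_compose:
  assumes "A \<in> bounded_ops" "B \<in> bounded_ops"
  shows "adj (A o\<^sub>L B) = adj B o\<^sub>L adj A"
  using assms by (intro adj_eqI compose_in_bounded_ops) (simp_all add: inner_adj)

lemma adj_adj:
  assumes "T \<in> bounded_ops"
  shows "adj (adj T) = T"
  by (intro adj_eqI adj_in_bounded_ops assms) (metis assms inner_adj inner_commute)

lemma unitaryI:
  assumes "U \<in> bounded_ops"
    and "\<And>x y. inner (blinfun_apply U x) y = inner x (blinfun_apply V y)"
    and "V o\<^sub>L U = id_blinfun" "U o\<^sub>L V = id_blinfun"
  shows "U \<in> unitary_ops" "adj U = V"
  using adj_eqI[OF assms(1,2)] assms by (auto simp: unitary_ops_def)

lemma unitaryD:
  assumes "U \<in> unitary_ops"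
  shows "U \<in> bounded_ops" "adj U o\<^sub>L U = id_blinfun" "U o\<^sub>L adj U = id_blinfun"
    "blinfun_apply (adj U) (blinfun_apply U x) = x"
    "blinfun_apply U (blinfun_apply (adj U) x) = x"
proof -
  show *: "U \<in> bounded_ops" "adj U o\<^sub>L U = id_blinfun" "U o\<^sub>L adj U = id_blinfun"
    using assms by (auto simp: unitary_ops_def)
  show "adj U (U x) = x" "U (adj U x) = x"
    using *(2,3) by (metis blinfun_apply_blinfun_compose blinfun_apply_id_blinfun)+
qed

lemma id_in_unitary_ops [simp]: "id_blinfun \<in> unitary_ops"
  and adj_id [simp]: "adj id_blinfun = id_blinfun"
  by (rule unitaryI[where V = id_blinfun]; simp add: blinfun_eqI)+

lemma adj_in_unitary_ops: "U \<in> unitary_ops \<Longrightarrow> adj U \<in> unitary_ops"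
  by (simp add: unitary_ops_def adj_in_bounded_ops adj_adj)

lemma compose_in_unitary_ops:
  assumes "U \<in> unitary_ops" "V \<in> unitary_ops"
  shows "U o\<^sub>L V \<in> unitary_ops"
proof (rule unitaryI)
  show "U o\<^sub>L V \<in> bounded_ops"
    using assms by (intro compose_in_bounded_ops unitaryD)
  show "inner ((U o\<^sub>L V) x) y = inner x ((adj V o\<^sub>L adj U) y)" for x y
    using assms by (simp add: inner_adj unitaryD)
qed (use assms in \<open>auto intro!: blinfun_eqI simp: unitaryD\<close>)

lemma minus_id_in_unitary_ops: "- id_blinfun \<in> unitary_ops"
  by (rule unitaryI[where V = "- id_blinfun"])
    (auto intro!: blinfun_eqI simp: bounded_ops_def blinfun.bilinear_simps scaleC_minus_right)

lemma norm_unitary: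
  assumes "U \<in> unitary_ops"
  shows "norm (blinfun_apply U x) = norm x"
proof -
  have "(norm (U x))\<^sup>2 = (norm x)\<^sup>2"
    using assms by (simp add: power2_norm_eq_inner inner_adj unitaryD)
  then show ?thesis by simp
qed

lemma group_unitary_group: "group (unitary_group :: ('a::complex_hilbert_space \<Rightarrow>\<^sub>L 'a) monoid)"
proof (rule groupI)
  fix U :: "'a \<Rightarrow>\<^sub>L 'a"
  assume "U \<in> carrier unitary_group"
  then show "\<exists>V\<in>carrier unitary_group. V \<otimes>\<^bsub>unitary_group\<^esub> U = \<one>\<^bsub>unitary_group\<^esub>"
    by (intro bexI[of _ "adj U"]) (simp_all add: unitary_group_def unitaryD adj_in_unitary_ops)
qed (auto simp: unitary_group_def compose_in_unitary_ops intro!: blinfun_eqI)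

section \<open>The action on the space of pairs\<close>

lemma projectionsD:
  assumes "P \<in> projections"
  shows "P \<in> bounded_ops" "adj P = P" "blinfun_apply P (blinfun_apply P x) = blinfun_apply P x"
    "inner (blinfun_apply P x) y = inner x (blinfun_apply P y)"
    "cinner (blinfun_apply P x) y = cinner x (blinfun_apply P y)"
proof -
  show *: "P \<in> bounded_ops" "adj P = P"
    using assms by (auto simp: projections_def)
  show "P (P x) = P x"
    using assms by (metis (mono_tags, lifting) blinfun_apply_blinfun_compose mem_Collect_eq projections_def)
  show "inner (P x) y = inner x (P y)" "cinner (P x) y = cinner x (P y)"
    using * by (metis inner_adj) (use * in \<open>metis cinner_adj\<close>)
qed

lemma conj_in_projections:
  assumes "P \<in> projections" "U \<in> unitary_ops"
  shows "U o\<^sub>L P o\<^sub>L adj U \<in> projections"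
proof -
  have b: "U \<in> bounded_ops" "adj U \<in> bounded_ops" "P \<in> bounded_ops"
    using assms by (auto intro: unitaryD projectionsD adj_in_bounded_ops)
  have "adj (U o\<^sub>L P o\<^sub>L adj U) = U o\<^sub>L (P o\<^sub>L adj U)"
    using b assms by (simp add: adj_compose compose_in_bounded_ops adj_adj projectionsD)
  then show ?thesis
    using b assms unfolding projections_def
    by (auto intro!: blinfun_eqI compose_in_bounded_ops simp: unitaryD projectionsD(3)[OF assms(1)])
qed

lemma unitary_act_id: "unitary_act id_blinfun b = b"
  by (auto simp: unitary_act_def split: prod.splits intro!: blinfun_eqI)

lemma unitary_act_compose:
  assumes "U \<in> unitary_ops" "V \<in> unitary_ops"
  shows "unitary_act (U o\<^sub>L V) b = unitary_act U (unitary_act V b)"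
  using assms
  by (auto simp: unitary_act_def adj_compose unitaryD split: prod.splits intro!: blinfun_eqI)

lemma unitary_act_in_orbit:
  assumes U: "U \<in> unitary_ops" and b: "b \<in> proj_vec_orbit P\<^sub>0"
  shows "unitary_act U b \<in> proj_vec_orbit P\<^sub>0"
proof -
  obtain P f W where Pf: "b = (P, f)" "P \<in> projections" "P f = f" "norm f = 1"
    and W: "W \<in> unitary_ops" "P = W o\<^sub>L P\<^sub>0 o\<^sub>L adj W"
    using b by (auto simp: proj_vec_orbit_def proj_vec_def)
  have "U o\<^sub>L P o\<^sub>L adj U = (U o\<^sub>L W) o\<^sub>L P\<^sub>0 o\<^sub>L adj (U o\<^sub>L W)"
    using U W by (auto simp: adj_compose unitaryD intro!: blinfun_eqI)
  then have "\<exists>W\<in>unitary_ops. U o\<^sub>L P o\<^sub>L adj U = W o\<^sub>L P\<^sub>0 o\<^sub>L adj W"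
    using compose_in_unitary_ops[OF U W(1)] by blast
  then show ?thesis
    using U Pf by (simp add: unitary_act_def proj_vec_orbit_def proj_vec_def
        conj_in_projections norm_unitary unitaryD)
qed

text \<open>
  Unitaries act by bijections of the orbit, the inverse of the action of \<open>U\<close> being that of \<open>U\<^sup>*\<close>.
\<close>

lemma group_action_orbit:
  "group_action unitary_group (proj_vec_orbit P\<^sub>0) (\<lambda>U. restrict (unitary_act U) (proj_vec_orbit P\<^sub>0))"
proof -
  let ?E = "proj_vec_orbit P\<^sub>0" and ?\<phi> = "\<lambda>U. restrict (unitary_act U) (proj_vec_orbit P\<^sub>0)"
  have Bij: "?\<phi> U \<in> Bij ?E" if U: "U \<in> unitary_ops" for U
  proof -
    have inv: "unitary_act (adj U) (unitary_act U b) = b" "unitary_act U (unitary_act (adj U) b) = b"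
      for b
      using unitary_act_compose[of "adj U" U b] unitary_act_compose[of U "adj U" b] U
      by (simp_all add: adj_in_unitary_ops unitaryD unitary_act_id)
    have "bij_betw (unitary_act U) ?E ?E"
      by (rule bij_betw_byWitness[where f' = "unitary_act (adj U)"])
        (simp_all add: inv image_subset_iff unitary_act_in_orbit adj_in_unitary_ops U)
    moreover have "bij_betw (?\<phi> U) ?E ?E = bij_betw (unitary_act U) ?E ?E"
      by (rule bij_betw_cong) simp
    ultimately show ?thesis
      by (simp add: Bij_def)
  qed
  have "group_hom unitary_group (BijGroup ?E) ?\<phi>"
  proof (intro group_hom.intro group_hom_axioms.intro homI group_unitary_group group_BijGroup)
    show "?\<phi> U \<in> carrier (BijGroup ?E)" if "U \<in> carrier unitary_group" for U
      using Bij that by (simp add: BijGroup_def unitary_group_def)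
    show "?\<phi> (U \<otimes>\<^bsub>unitary_group\<^esub> V) = ?\<phi> U \<otimes>\<^bsub>BijGroup ?E\<^esub> ?\<phi> V"
      if "U \<in> carrier unitary_group" "V \<in> carrier unitary_group" for U V
    proof -
      have UV: "U \<in> unitary_ops" "V \<in> unitary_ops"
        using that by (auto simp: unitary_group_def)
      then have "?\<phi> (U o\<^sub>L V) = compose ?E (?\<phi> U) (?\<phi> V)"
        by (intro ext) (simp add: compose_def unitary_act_compose unitary_act_in_orbit)
      then show ?thesis
        using UV Bij by (simp add: BijGroup_def unitary_group_def)
    qed
  qed
  then show ?thesis by (rule group_action.intro)
qed


section \<open>Moving a unit vector inside the range of a projection\<close>

text \<open>
  The complex rank-one operator \<open>x \<mapsto> \<langle>x, u\<rangle> w\<close>, written as a sum of two real rank-one operators so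
  that its norm continuity in \<open>u\<close> and \<open>w\<close> follows from that of bounded bilinear maps.
\<close>

definition outer :: "'a::complex_hilbert_space \<Rightarrow> 'a \<Rightarrow> 'a \<Rightarrow>\<^sub>L 'a"
  where "outer u w = (blinfun_scaleR_left w o\<^sub>L blinfun_inner_left u) +
    (blinfun_scaleR_left (imult w) o\<^sub>L blinfun_inner_left (imult u))"

lemma cinner_eq_inner: "cinner x y = Complex (inner x y) (inner x (imult y))"
  by (rule complex_eqI) (simp_all add: inner_eq_Re_cinner cinner_scaleC_right)

lemma outer_apply [simp]: "blinfun_apply (outer u w) x = cinner x u *\<^sub>C w"
  by (subst scaleC_Re_Im) (simp add: outer_def blinfun.bilinear_simps cinner_eq_inner)

lemma continuous_on_outer:
  assumes "continuous_on S u" "continuous_on S w"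
  shows "continuous_on S (\<lambda>z. outer (u z) (w z))"
  unfolding outer_def
  by (intro continuous_on_add bounded_bilinear.continuous_on[OF bounded_bilinear_blinfun_compose]
      bounded_linear.continuous_on[OF bounded_linear_blinfun_scaleR_left]
      bounded_linear.continuous_on[OF bounded_linear_blinfun_inner_left]
      bounded_linear.continuous_on[OF blinfun.bounded_linear_right] assms)

lemma continuous_on_cinner:
  fixes u w :: "'b::topological_space \<Rightarrow> 'a::complex_hilbert_space"
  assumes "continuous_on S u" "continuous_on S w"
  shows "continuous_on S (\<lambda>z. cinner (u z) (w z))"
  unfolding cinner_eq_inner Complex_eq
  by (intro continuous_intros bounded_linear.continuous_on[OF blinfun.bounded_linear_right] assms)

lemma continuous_on_scaleC:
  fixes w :: "'b::topological_space \<Rightarrow> 'a::complex_hilbert_space"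
  assumes "continuous_on S c" "continuous_on S w"
  shows "continuous_on S (\<lambda>z. c z *\<^sub>C w z)"
  unfolding scaleC_Re_Im[of "c z" "w z" for z] imult_apply[symmetric]
  by (intro continuous_intros bounded_linear.continuous_on[OF blinfun.bounded_linear_right] assms)

text \<open>
  The sign is chosen so that \<open>f + g\<close> and not \<open>f - g\<close> appears: the family is then continuous near
  \<open>f = g\<close>, where it is the reflection fixing \<open>f\<close>, and only \<open>g = - f\<close> is excluded. A Householder
  reflection built from \<open>f - g\<close> has in general no limit as \<open>g\<close> tends to \<open>f\<close>.
\<close>

definition carry :: "'a::complex_hilbert_space \<Rightarrow> 'a \<Rightarrow> 'a \<Rightarrow>\<^sub>L 'a"
  where "carry f g = outer (f + g) ((1 / cinner f (f + g)) *\<^sub>C (f + g)) - id_blinfun"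

lemma carry_apply:
  "blinfun_apply (carry f g) x = (cinner x (f + g) / cinner f (f + g)) *\<^sub>C (f + g) - x"
  by (simp add: carry_def blinfun.bilinear_simps scaleC_scaleC)

text \<open>
  The numbers \<open>c = \<langle>f, u\<rangle>\<close> and \<open>\<langle>g, u\<rangle>\<close> with \<open>u = f + g\<close> are conjugate because
  \<open>\<langle>f, f\<rangle> = \<langle>g, g\<rangle>\<close>, so \<open>\<parallel>u\<parallel>\<^sup>2 = 2 Re c\<close>, which forces \<open>c \<noteq> 0\<close>.
\<close>

lemma cinner_sum_equal_norms:
  fixes f g :: "'a::complex_hilbert_space"
  assumes "norm f = norm g" "f + g \<noteq> 0"
  shows "cnj (cinner f (f + g)) = cinner g (f + g)"
    and "cinner (f + g) (f + g) = cinner f (f + g) + cinner g (f + g)"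
    and "cinner f (f + g) \<noteq> 0"
proof -
  have "cnj (cinner f (f + g)) = cinner f f + cinner g f"
    by (metis cinner_commute cinner_add_left)
  also have "cinner f f = cinner g g"
    using assms(1) by (simp add: cinner_self)
  finally show cnj: "cnj (cinner f (f + g)) = cinner g (f + g)"
    by (simp add: cinner_add_right)
  show sum: "cinner (f + g) (f + g) = cinner f (f + g) + cinner g (f + g)"
    by (rule cinner_add_left)
  show "cinner f (f + g) \<noteq> 0"
  proof
    assume "cinner f (f + g) = 0"
    with cnj sum have "cinner (f + g) (f + g) = 0" by simp
    with assms(2) show False by (simp add: cinner_self)
  qed
qed

lemma carry_moves:
  assumes "norm f = norm g" "f + g \<noteq> 0"
  shows "blinfun_apply (carry f g) f = g"
proof -
  have "1 *\<^sub>C (f + g) = f + g"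
    using scaleC_of_real[of 1 "f + g"] by simp
  then show ?thesis
    using cinner_sum_equal_norms(3)[OF assms] by (simp add: carry_apply)
qed

text \<open>
  Composing the two maps leaves the identity plus a multiple of \<open>\<langle>x, u\<rangle> u\<close>, whose coefficient is
  proportional to \<open>\<langle>u, u\<rangle> - \<langle>f, u\<rangle> - \<langle>g, u\<rangle> = 0\<close>.
\<close>

lemma carry_inverse:
  fixes f g :: "'a::complex_hilbert_space"
  assumes "norm f = norm g" "f + g \<noteq> 0"
  shows "carry g f o\<^sub>L carry f g = id_blinfun"
proof (rule blinfun_eqI)
  fix x
  define u where "u = f + g"
  have nz: "cinner f u \<noteq> 0" "cinner g u \<noteq> 0"
    using cinner_sum_equal_norms[OF assms] by (auto simp: u_def)
  have uu: "cinner u u = cinner f u + cinner g u"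
    using cinner_sum_equal_norms[OF assms] by (simp add: u_def)
  let ?a = "cinner x u"
  have fg: "carry f g x = (?a / cinner f u) *\<^sub>C u - x"
    by (simp add: carry_apply u_def)
  have gf: "carry g f y = (cinner y u / cinner g u) *\<^sub>C u - y" for y
    by (simp add: carry_apply u_def add.commute)
  have "cinner (carry f g x) u / cinner g u = ?a / cinner f u"
    using nz by (simp add: fg cinner_diff_left cinner_scaleC_left uu field_simps)
  then have "carry g f (carry f g x) = (?a / cinner f u) *\<^sub>C u - carry f g x"
    by (simp add: gf)
  then show "(carry g f o\<^sub>L carry f g) x = id_blinfun x"
    by (simp add: fg)
qed

text \<open>
  Conjugacy of the two denominators makes \<open>carry g f\<close> the adjoint of \<open>carry f g\<close>.
\<close>

lemma carry_unitary:
  fixes f g :: "'a::complex_hilbert_space"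
  assumes "norm f = norm g" "f + g \<noteq> 0"
  shows "carry f g \<in> unitary_ops"
proof -
  have b: "carry f g \<in> bounded_ops"
    by (simp add: bounded_ops_def carry_apply cinner_scaleC_left scaleC_diff_right scaleC_scaleC)
  have sym: "inner (carry f g x) y = inner x (carry g f y)" for x y
  proof -
    define u where "u = f + g"
    have "cnj (cinner g u) = cinner f u"
      using cinner_sum_equal_norms(1)[OF assms] by (metis complex_cnj_cnj u_def)
    then have "cinner ((cinner x u / cinner f u) *\<^sub>C u) y = cinner x ((cinner y u / cinner g u) *\<^sub>C u)"
      by (simp add: cinner_scaleC_left cinner_scaleC_right cinner_commute[of u y])
    then have "inner ((cinner x u / cinner f u) *\<^sub>C u) y = inner x ((cinner y u / cinner g u) *\<^sub>C u)"
      by (simp add: inner_eq_Re_cinner)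
    then show ?thesis
      by (simp add: carry_apply u_def add.commute inner_diff_left inner_diff_right)
  qed
  have "carry f g o\<^sub>L carry g f = id_blinfun"
    using assms by (intro carry_inverse) (simp_all add: add.commute)
  then show ?thesis
    using unitaryI(1)[OF b sym carry_inverse[OF assms]] by blast
qed

lemma carry_commutes:
  assumes P: "P \<in> projections" and "blinfun_apply P f = f" "blinfun_apply P g = g"
  shows "carry f g o\<^sub>L P = P o\<^sub>L carry f g"
proof (rule blinfun_eqI)
  fix x
  have "P (f + g) = f + g"
    using assms by (simp add: blinfun.bilinear_simps)
  moreover from this have "cinner (P x) (f + g) = cinner x (f + g)"
    using P by (simp add: projectionsD)
  ultimately show "(carry f g o\<^sub>L P) x = (P o\<^sub>L carry f g) x"
    using P by (simp add: carry_apply blinfun.diff_right bounded_opsD[OF projectionsD(1)])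
qed

lemma continuous_on_carry:
  fixes a b :: "'b::topological_space \<Rightarrow> 'a::complex_hilbert_space"
  assumes "continuous_on S a" "continuous_on S b"
    and "\<And>z. z \<in> S \<Longrightarrow> norm (a z) = norm (b z)" "\<And>z. z \<in> S \<Longrightarrow> a z + b z \<noteq> 0"
  shows "continuous_on S (\<lambda>z. carry (a z) (b z))"
  unfolding carry_def using cinner_sum_equal_norms(3) assms
  by (intro continuous_on_diff continuous_on_outer continuous_on_scaleC continuous_on_divide
      continuous_on_cinner continuous_on_const continuous_on_add) auto

lemma conj_eq_of_commute:
  assumes "V \<in> unitary_ops" "V o\<^sub>L P = P o\<^sub>L V"
  shows "V o\<^sub>L P o\<^sub>L adj V = P"
proof -
  have "V o\<^sub>L P o\<^sub>L adj V = P o\<^sub>L (V o\<^sub>L adj V)"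
    unfolding assms(2) by (auto intro!: blinfun_eqI)
  then show ?thesis
    using assms(1) by (auto simp: unitaryD intro!: blinfun_eqI)
qed

text \<open>
  The unitary \<open>W\<close> between the two projections comes from the definition of the orbit. The correcting
  unitary is \<open>carry (W f) g\<close>, except that \<open>-1\<close> takes over when \<open>g = - W f\<close>.
\<close>

lemma orbit_transitive:
  fixes P\<^sub>0 :: "'a::complex_hilbert_space \<Rightarrow>\<^sub>L 'a"
  assumes b: "b \<in> proj_vec_orbit P\<^sub>0" and c: "c \<in> proj_vec_orbit P\<^sub>0"
  shows "\<exists>U\<in>unitary_ops. unitary_act U b = c"
proof -
  obtain P f W\<^sub>1 where Pf: "b = (P, f)" "P \<in> projections" "P f = f" "norm f = 1"
    and W\<^sub>1: "W\<^sub>1 \<in> unitary_ops" "P = W\<^sub>1 o\<^sub>L P\<^sub>0 o\<^sub>L adj W\<^sub>1"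
    using b by (auto simp: proj_vec_orbit_def proj_vec_def)
  obtain Q g W\<^sub>2 where Qg: "c = (Q, g)" "Q \<in> projections" "Q g = g" "norm g = 1"
    and W\<^sub>2: "W\<^sub>2 \<in> unitary_ops" "Q = W\<^sub>2 o\<^sub>L P\<^sub>0 o\<^sub>L adj W\<^sub>2"
    using c by (auto simp: proj_vec_orbit_def proj_vec_def)
  define W where "W = W\<^sub>2 o\<^sub>L adj W\<^sub>1"
  have W: "W \<in> unitary_ops"
    using W\<^sub>1 W\<^sub>2 by (simp add: W_def compose_in_unitary_ops adj_in_unitary_ops)
  have "W o\<^sub>L P = Q o\<^sub>L W"
    using W\<^sub>1(1) W\<^sub>2(1) by (auto simp: W_def W\<^sub>1(2) W\<^sub>2(2) unitaryD intro!: blinfun_eqI)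
  then have WQ: "W (P x) = Q (W x)" for x
    by (metis blinfun_apply_blinfun_compose)
  then have WP: "unitary_act W b = (Q, W f)"
    using W by (auto simp: unitary_act_def Pf(1) unitaryD intro!: blinfun_eqI)
  have Qh: "Q (W f) = W f"
    using WQ[of f] Pf(3) by simp
  have "\<exists>V\<in>unitary_ops. V o\<^sub>L Q = Q o\<^sub>L V \<and> V (W f) = g"
  proof (cases "W f + g = 0")
    case True
    then have "(- id_blinfun) (W f) = g"
      by (simp add: blinfun.bilinear_simps minus_unique)
    moreover have "(- id_blinfun) o\<^sub>L Q = Q o\<^sub>L (- id_blinfun)"
      by (auto simp: blinfun.bilinear_simps intro!: blinfun_eqI)
    ultimately show ?thesis
      using minus_id_in_unitary_ops by blast
  next
    case False
    have "norm (W f) = norm g"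
      using W Pf Qg by (simp add: norm_unitary)
    with False show ?thesis
      using carry_unitary carry_moves carry_commutes[OF Qg(2) Qh Qg(3)] by blast
  qed
  then obtain V where V: "V \<in> unitary_ops" "V o\<^sub>L Q = Q o\<^sub>L V" "V (W f) = g" by blast
  have "unitary_act (V o\<^sub>L W) b = c"
    using V conj_eq_of_commute[OF V(1,2)]
    by (simp add: unitary_act_compose W WP) (simp add: unitary_act_def Qg(1))
  then show ?thesis
    using V W compose_in_unitary_ops by blast
qed

section \<open>The inverse square root of an operator near the identity\<close>

lemma norm_compose_le:
  "norm A \<le> a \<Longrightarrow> norm B \<le> b \<Longrightarrow> norm (A o\<^sub>L B) \<le> a * b"
  by (rule order_trans[OF norm_blinfun_compose]) (auto intro!: mult_mono order_trans[OF norm_ge_zero])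

text \<open>
  Writing \<open>K = 1 + Y\<close>, the equation \<open>(1 - E) K\<^sup>2 = 1\<close> reads \<open>2 Y = E (1 + Y)\<^sup>2 - Y\<^sup>2\<close>. The fixed
  points of this map are thus the \<open>Y\<close> for which \<open>1 + Y\<close> is an inverse square root of \<open>1 - E\<close>.
\<close>

definition sqrt_step :: "('a::real_normed_vector \<Rightarrow>\<^sub>L 'a) \<Rightarrow> ('a \<Rightarrow>\<^sub>L 'a) \<Rightarrow> 'a \<Rightarrow>\<^sub>L 'a"
  where "sqrt_step E Y = (1/2) *\<^sub>R ((E o\<^sub>L ((id_blinfun + Y) o\<^sub>L (id_blinfun + Y))) - (Y o\<^sub>L Y))"

lemma norm_id_add_le: "norm Y \<le> 1/2 \<Longrightarrow> norm (id_blinfun + Y) \<le> 3/2"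
  using norm_triangle_ineq[of id_blinfun Y] norm_blinfun_id_le by (smt (verit) field_sum_of_halves)

lemma sqrt_step_norm:
  assumes "norm E \<le> 1/4" "norm Y \<le> 1/2"
  shows "norm (sqrt_step E Y) \<le> 1/2"
proof -
  have "norm (E o\<^sub>L ((id_blinfun + Y) o\<^sub>L (id_blinfun + Y))) \<le> 1/4 * (3/2 * (3/2))"
    using assms by (intro norm_compose_le norm_id_add_le)
  moreover have "norm (Y o\<^sub>L Y) \<le> 1/2 * (1/2)"
    using assms by (intro norm_compose_le)
  ultimately show ?thesis
    unfolding sqrt_step_def norm_scaleR
    using norm_triangle_ineq4[of "E o\<^sub>L ((id_blinfun + Y) o\<^sub>L (id_blinfun + Y))" "Y o\<^sub>L Y"]
    by simp
qed

text \<open>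
  For \<open>E = E'\<close> this is the contraction property with factor \<open>7/8\<close>; letting \<open>E\<close> vary as well gives
  the dependence of the fixed point on \<open>E\<close>.
\<close>

lemma sqrt_step_lipschitz:
  assumes "norm E \<le> 1/4" "norm E' \<le> 1/4" "norm Y \<le> 1/2" "norm Y' \<le> 1/2"
  shows "norm (sqrt_step E Y - sqrt_step E' Y') \<le> 9/8 * norm (E - E') + 7/8 * norm (Y - Y')"
proof -
  define A where "A = (E - E') o\<^sub>L ((id_blinfun + Y) o\<^sub>L (id_blinfun + Y))"
  define B where "B = E' o\<^sub>L (((Y - Y') o\<^sub>L (id_blinfun + Y)) + ((id_blinfun + Y') o\<^sub>L (Y - Y')))"
  define C where "C = (Y o\<^sub>L (Y - Y')) + ((Y - Y') o\<^sub>L Y')"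
  have "sqrt_step E Y - sqrt_step E' Y' = (1/2) *\<^sub>R (A + B - C)"
    by (rule blinfun_eqI)
      (simp add: sqrt_step_def A_def B_def C_def blinfun.bilinear_simps algebra_simps)
  moreover have "norm A \<le> norm (E - E') * (3/2 * (3/2))"
    unfolding A_def using assms by (intro norm_compose_le norm_id_add_le) auto
  moreover have "norm B \<le> 1/4 * (norm (Y - Y') * (3/2) + 3/2 * norm (Y - Y'))"
    unfolding B_def using assms
    by (intro norm_compose_le norm_triangle_le add_mono norm_id_add_le) auto
  moreover have "norm C \<le> 1/2 * norm (Y - Y') + norm (Y - Y') * (1/2)"
    unfolding C_def using assms by (intro norm_compose_le norm_triangle_le add_mono) auto
  moreover have "norm (A + B - C) \<le> norm A + norm B + norm C"
    by (smt (verit) norm_triangle_ineq norm_triangle_ineq4)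
  ultimately show ?thesis by simp
qed

text \<open>
  The bound by \<open>1/2\<close> singles out one branch of \<open>(1 - E)\<^sup>-\<^sup>1\<^sup>/\<^sup>2\<close>.
\<close>

definition is_inv_sqrt :: "('a::real_inner \<Rightarrow>\<^sub>L 'a) \<Rightarrow> ('a \<Rightarrow>\<^sub>L 'a) \<Rightarrow> bool"
  where "is_inv_sqrt E K \<longleftrightarrow> norm (K - id_blinfun) \<le> 1/2 \<and>
    (\<forall>X. X o\<^sub>L E = E o\<^sub>L X \<longrightarrow> X o\<^sub>L K = K o\<^sub>L X) \<and>
    (\<forall>x y. inner (blinfun_apply K x) y = inner x (blinfun_apply K y)) \<and>
    (K o\<^sub>L K) - (E o\<^sub>L (K o\<^sub>L K)) = id_blinfun"

lemma sqrt_step_fixed_iff: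
  "sqrt_step E (K - id_blinfun) = K - id_blinfun \<longleftrightarrow> (K o\<^sub>L K) - (E o\<^sub>L (K o\<^sub>L K)) = id_blinfun"
proof -
  have "(K - id_blinfun) o\<^sub>L (K - id_blinfun) = (K o\<^sub>L K) - 2 *\<^sub>R K + id_blinfun"
    by (rule blinfun_eqI) (simp add: blinfun.bilinear_simps scaleR_2 algebra_simps)
  then have "2 *\<^sub>R (K - id_blinfun - sqrt_step E (K - id_blinfun)) =
      (K o\<^sub>L K) - (E o\<^sub>L (K o\<^sub>L K)) - id_blinfun"
    by (simp add: sqrt_step_def algebra_simps scaleR_2)
  then show ?thesis
    by (metis (no_types, lifting) right_minus_eq scaleR_eq_0_iff zero_neq_numeral)
qed

text \<open>
  Banach's fixed point theorem is applied on the closed set of symmetric operators in the ball of radius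
  \<open>1/2\<close> that commute with the commutant of \<open>E\<close>. As \<open>sqrt_step E\<close> preserves this set, the fixed
  point inherits symmetry and commutation from it.
\<close>

lemma inv_sqrt_exists:
  fixes E :: "'a::{real_inner,banach} \<Rightarrow>\<^sub>L 'a"
  assumes E: "norm E \<le> 1/4" and sym: "\<And>x y. inner (blinfun_apply E x) y = inner x (blinfun_apply E y)"
  shows "\<exists>K. is_inv_sqrt E K"
proof -
  define A where "A = cball 0 (1/2) \<inter> (\<Inter>X\<in>{X. X o\<^sub>L E = E o\<^sub>L X}. {Y. X o\<^sub>L Y = Y o\<^sub>L X}) \<inter>
    (\<Inter>x. \<Inter>y. {Y. inner (blinfun_apply Y x) y = inner x (blinfun_apply Y y)})"
  have "closed A"
    unfolding A_def
    by (intro closed_Int closed_INT closed_cball closed_Collect_eq ballI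
        bounded_bilinear.continuous_on[OF bounded_bilinear_blinfun_compose]
        continuous_on_inner bounded_linear.continuous_on[OF blinfun.bounded_linear_left]
        continuous_on_const continuous_on_id)
  then have "complete A" by (simp add: complete_eq_closed)
  moreover have "0 \<in> A" by (auto simp: A_def blinfun.bilinear_simps)
  moreover have "sqrt_step E ` A \<subseteq> A"
  proof safe
    fix Y assume Y: "Y \<in> A"
    then have nY: "norm Y \<le> 1/2"
      and comm: "\<And>X. X o\<^sub>L E = E o\<^sub>L X \<Longrightarrow> X o\<^sub>L Y = Y o\<^sub>L X"
      and symY: "\<And>x y. inner (Y x) y = inner x (Y y)"
      by (auto simp: A_def)
    have EY: "E (Y x) = Y (E x)" for x
      using comm[of E] by (metis blinfun_apply_blinfun_compose)
    have "X o\<^sub>L sqrt_step E Y = sqrt_step E Y o\<^sub>L X" if X: "X o\<^sub>L E = E o\<^sub>L X" for X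
    proof -
      have "X (E x) = E (X x)" "X (Y x) = Y (X x)" for x
        using X comm[OF X] by (metis blinfun_apply_blinfun_compose)+
      then show ?thesis
        by (intro blinfun_eqI) (simp add: sqrt_step_def blinfun.bilinear_simps)
    qed
    moreover have "inner (sqrt_step E Y x) y = inner x (sqrt_step E Y y)" for x y
      by (simp add: sqrt_step_def blinfun.bilinear_simps inner_add_left inner_add_right
          inner_diff_left inner_diff_right sym symY EY)
    ultimately show "sqrt_step E Y \<in> A"
      using sqrt_step_norm[OF E nY] by (auto simp: A_def)
  qed
  moreover have "dist (sqrt_step E Y) (sqrt_step E Y') \<le> 7/8 * dist Y Y'"
    if "Y \<in> A" "Y' \<in> A" for Y Y'
    using sqrt_step_lipschitz[OF E E, of Y Y'] that by (simp add: A_def dist_norm)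
  ultimately obtain Y where Y: "Y \<in> A" "sqrt_step E Y = Y"
    using Banach_fix[of A "7/8" "sqrt_step E"] by auto
  have "is_inv_sqrt E (id_blinfun + Y)"
    unfolding is_inv_sqrt_def
  proof (intro conjI allI impI)
    show "norm (id_blinfun + Y - id_blinfun) \<le> 1/2"
      using Y(1) by (simp add: A_def)
    show "X o\<^sub>L (id_blinfun + Y) = (id_blinfun + Y) o\<^sub>L X" if "X o\<^sub>L E = E o\<^sub>L X" for X
    proof -
      have "X o\<^sub>L Y = Y o\<^sub>L X" using Y(1) that by (simp add: A_def)
      then have "X (Y x) = Y (X x)" for x by (metis blinfun_apply_blinfun_compose)
      then show ?thesis
        by (intro blinfun_eqI) (simp add: blinfun.bilinear_simps)
    qed
    show "inner ((id_blinfun + Y) x) y = inner x ((id_blinfun + Y) y)" for x y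
      using Y(1) by (simp add: A_def blinfun.bilinear_simps inner_add_left inner_add_right)
    show "((id_blinfun + Y) o\<^sub>L (id_blinfun + Y)) - (E o\<^sub>L ((id_blinfun + Y) o\<^sub>L (id_blinfun + Y)))
        = id_blinfun"
      using Y(2) by (subst sqrt_step_fixed_iff[symmetric]) simp
  qed
  then show ?thesis by blast
qed

definition inv_sqrt :: "('a::real_inner \<Rightarrow>\<^sub>L 'a) \<Rightarrow> 'a \<Rightarrow>\<^sub>L 'a"
  where "inv_sqrt E = (SOME K. is_inv_sqrt E K)"

lemma is_inv_sqrt_inv_sqrt:
  fixes E :: "'a::{real_inner,banach} \<Rightarrow>\<^sub>L 'a"
  assumes "norm E \<le> 1/4" "\<And>x y. inner (blinfun_apply E x) y = inner x (blinfun_apply E y)"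
  shows "is_inv_sqrt E (inv_sqrt E)"
  unfolding inv_sqrt_def by (rule someI_ex[OF inv_sqrt_exists[OF assms]])

text \<open>
  With \<open>d = \<parallel>K - K'\<parallel>\<close>, the estimate for the two fixed points is
  \<open>d \<le> 9/8 \<parallel>E - E'\<parallel> + 7/8 d\<close>. For \<open>E = E'\<close> it gives uniqueness.
\<close>

lemma is_inv_sqrt_lipschitz:
  assumes "is_inv_sqrt E K" "is_inv_sqrt E' K'" "norm E \<le> 1/4" "norm E' \<le> 1/4"
  shows "norm (K - K') \<le> 9 * norm (E - E')"
proof -
  let ?Y = "K - id_blinfun" and ?Y' = "K' - id_blinfun"
  have "sqrt_step E ?Y = ?Y" "sqrt_step E' ?Y' = ?Y'" "norm ?Y \<le> 1/2" "norm ?Y' \<le> 1/2"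
    using assms(1,2) unfolding is_inv_sqrt_def sqrt_step_fixed_iff by blast+
  then have "norm (?Y - ?Y') \<le> 9/8 * norm (E - E') + 7/8 * norm (?Y - ?Y')"
    using sqrt_step_lipschitz[of E E' ?Y ?Y'] assms by simp
  then show ?thesis by simp
qed

section \<open>The direct rotation between two close projections\<close>

text \<open>
  This is the unitary factor in the polar decomposition of \<open>Z = PQ + (1 - P)(1 - Q)\<close>, as
  \<open>Z\<^sup>*Z = 1 - (P - Q)\<^sup>2\<close>.
\<close>

definition direct_rotation :: "('a::real_inner \<Rightarrow>\<^sub>L 'a) \<Rightarrow> ('a \<Rightarrow>\<^sub>L 'a) \<Rightarrow> 'a \<Rightarrow>\<^sub>L 'a"
  where "direct_rotation Q P =
    ((P o\<^sub>L Q) + ((id_blinfun - P) o\<^sub>L (id_blinfun - Q))) o\<^sub>L inv_sqrt ((P - Q) o\<^sub>L (P - Q))"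

lemma is_inv_sqrt_projections:
  assumes "P \<in> projections" "Q \<in> projections" "norm (P - Q) \<le> 1/2"
  shows "norm ((P - Q) o\<^sub>L (P - Q)) \<le> 1/4"
    and "is_inv_sqrt ((P - Q) o\<^sub>L (P - Q)) (inv_sqrt ((P - Q) o\<^sub>L (P - Q)))"
proof -
  show "norm ((P - Q) o\<^sub>L (P - Q)) \<le> 1/4"
    using norm_compose_le[OF assms(3,3)] by simp
  then show "is_inv_sqrt ((P - Q) o\<^sub>L (P - Q)) (inv_sqrt ((P - Q) o\<^sub>L (P - Q)))"
    by (rule is_inv_sqrt_inv_sqrt)
      (use assms in \<open>simp add: blinfun.bilinear_simps inner_diff_left inner_diff_right projectionsD\<close>)
qed

text \<open>
  All identities reduce to \<open>Z\<^sup>*Z = ZZ\<^sup>* = 1 - E\<close> and \<open>PZ = ZQ\<close>, because \<open>E = P + Q - PQ - QP\<close>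
  commutes with \<open>P\<close>, \<open>Q\<close> and the imaginary unit, hence so does \<open>K = (1 - E)\<^sup>-\<^sup>1\<^sup>/\<^sup>2\<close>.
\<close>

lemma direct_rotation:
  fixes P Q :: "'a::complex_hilbert_space \<Rightarrow>\<^sub>L 'a"
  assumes P: "P \<in> projections" and Q: "Q \<in> projections" and close: "norm (P - Q) \<le> 1/2"
  shows "direct_rotation Q P \<in> unitary_ops"
    and "direct_rotation Q P o\<^sub>L Q o\<^sub>L adj (direct_rotation Q P) = P"
proof -
  define E where "E = (P - Q) o\<^sub>L (P - Q)"
  define K where "K = inv_sqrt E"
  define Z where "Z = (P o\<^sub>L Q) + ((id_blinfun - P) o\<^sub>L (id_blinfun - Q))"
  define Z' where "Z' = (Q o\<^sub>L P) + ((id_blinfun - Q) o\<^sub>L (id_blinfun - P))"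
  let ?S = "direct_rotation Q P"
  have S: "?S = Z o\<^sub>L K"
    by (simp add: direct_rotation_def Z_def K_def E_def)
  note PQ = projectionsD(3)[OF P] projectionsD(3)[OF Q]
  have "is_inv_sqrt E K"
    using is_inv_sqrt_projections[OF assms] by (simp add: E_def K_def)
  then have comm: "\<And>X. X o\<^sub>L E = E o\<^sub>L X \<Longrightarrow> X o\<^sub>L K = K o\<^sub>L X"
    and symK: "\<And>x y. inner (K x) y = inner x (K y)"
    and sq: "(K o\<^sub>L K) - (E o\<^sub>L (K o\<^sub>L K)) = id_blinfun"
    unfolding is_inv_sqrt_def by blast+
  have sq': "K (K x) - E (K (K x)) = x" for x
    using arg_cong[OF sq, of "\<lambda>T. blinfun_apply T x"] by (simp add: blinfun.bilinear_simps)
  have E: "E x = P x + Q x - P (Q x) - Q (P x)" for x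
    by (simp add: E_def blinfun.bilinear_simps PQ)
  have "P o\<^sub>L K = K o\<^sub>L P" "Q o\<^sub>L K = K o\<^sub>L Q" "imult o\<^sub>L K = K o\<^sub>L imult" "E o\<^sub>L K = K o\<^sub>L E"
    by (intro comm; use P Q in \<open>auto intro!: blinfun_eqI simp: E blinfun.bilinear_simps PQ
      scaleC_add_right scaleC_diff_right bounded_opsD[OF projectionsD(1)]\<close>)+
  then have Kb: "K \<in> bounded_ops"
    and KP: "K (P x) = P (K x)" and KQ: "K (Q x) = Q (K x)" and KE: "K (E x) = E (K x)" for x
    by (auto simp: bounded_ops_iff_commute_imult) (metis blinfun_apply_blinfun_compose)+
  have ZZ: "Z' (Z x) = x - E x" "Z (Z' x) = x - E x" for x
    by (simp_all add: Z_def Z'_def E blinfun.bilinear_simps PQ)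
  have KZ': "K (Z' x) = Z' (K x)" for x
    by (simp add: Z'_def blinfun.bilinear_simps KP KQ)
  have b: "?S \<in> bounded_ops"
    unfolding S Z_def using P Q Kb
    by (intro compose_in_bounded_ops add_in_bounded_ops diff_in_bounded_ops) (auto simp: projectionsD)
  have adjS: "inner (?S x) y = inner x ((K o\<^sub>L Z') y)" for x y
  proof -
    have "inner (Z x) y = inner x (Z' y)" for x y
      using P Q by (simp add: Z_def Z'_def blinfun.bilinear_simps inner_add_left inner_add_right
          inner_diff_left inner_diff_right projectionsD)
    then show ?thesis by (simp add: S symK)
  qed
  have "(K o\<^sub>L Z') o\<^sub>L ?S = id_blinfun"
    by (rule blinfun_eqI) (simp add: S ZZ blinfun.diff_right KE sq')
  moreover have "?S o\<^sub>L (K o\<^sub>L Z') = id_blinfun"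
    by (rule blinfun_eqI) (simp add: S KZ' ZZ sq')
  ultimately show U: "?S \<in> unitary_ops"
    using unitaryI[OF b adjS] by auto
  have "?S o\<^sub>L Q = P o\<^sub>L ?S"
    by (rule blinfun_eqI) (simp add: S Z_def blinfun.bilinear_simps KQ PQ)
  then have "?S o\<^sub>L Q o\<^sub>L adj ?S = P o\<^sub>L (?S o\<^sub>L adj ?S)"
    by (auto intro!: blinfun_eqI)
  then show "?S o\<^sub>L Q o\<^sub>L adj ?S = P"
    using U by (auto simp: unitaryD intro!: blinfun_eqI)
qed

lemma direct_rotation_self:
  assumes "Q \<in> projections"
  shows "direct_rotation Q Q = id_blinfun"
proof -
  have "is_inv_sqrt 0 (inv_sqrt (0 :: 'a \<Rightarrow>\<^sub>L 'a))"
    by (rule is_inv_sqrt_inv_sqrt) (simp_all add: blinfun.bilinear_simps)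
  moreover have "is_inv_sqrt 0 (id_blinfun :: 'a \<Rightarrow>\<^sub>L 'a)"
    by (auto simp: is_inv_sqrt_def intro!: blinfun_eqI)
  ultimately have "inv_sqrt 0 = (id_blinfun :: 'a \<Rightarrow>\<^sub>L 'a)"
    using is_inv_sqrt_lipschitz[of 0 "inv_sqrt 0" 0 id_blinfun] by simp
  then show ?thesis
    using assms
    by (auto simp: direct_rotation_def blinfun.bilinear_simps projectionsD(3)[OF assms]
        intro!: blinfun_eqI)
qed

lemma continuous_on_direct_rotation:
  assumes Q: "Q \<in> projections"
  shows "continuous_on {P \<in> projections. norm (P - Q) \<le> 1/2} (direct_rotation Q)"
proof -
  let ?B = "{P \<in> projections. norm (P - Q) \<le> 1/2}" and ?E = "\<lambda>P. (P - Q) o\<^sub>L (P - Q)"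
  note compose = bounded_bilinear.continuous_on[OF bounded_bilinear_blinfun_compose]
  have "9-lipschitz_on (?E ` ?B) inv_sqrt"
    using is_inv_sqrt_projections[OF _ Q]
    by (auto intro!: lipschitz_onI is_inv_sqrt_lipschitz simp: dist_norm)
  then have "continuous_on (?E ` ?B) inv_sqrt"
    by (rule lipschitz_on_continuous_on)
  moreover have "continuous_on ?B ?E"
    by (intro compose continuous_intros)
  ultimately have "continuous_on ?B (\<lambda>P. inv_sqrt (?E P))"
    using continuous_on_compose2 by blast
  then show ?thesis
    unfolding direct_rotation_def by (intro compose continuous_intros)
qed

section \<open>Transitivity and local cross sections\<close>

text \<open>
  The neighbourhood has to guarantee \<open>\<parallel>P - P\<^sub>1\<parallel> \<le> 1/2\<close>, for the direct rotation, and
  \<open>S f\<^sub>1 + f \<noteq> 0\<close>, for the correction of the vector. Both conditions are open, and the second holds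
  at the centre because there \<open>S = 1\<close> and \<open>f = f\<^sub>1 \<noteq> 0\<close>.
\<close>

lemma local_section_at:
  fixes P\<^sub>1 :: "'a::complex_hilbert_space \<Rightarrow>\<^sub>L 'a"
  assumes b: "(P\<^sub>1, f\<^sub>1) \<in> proj_vec"
  shows "\<exists>V \<tau>. openin (top_of_set proj_vec) V \<and> (P\<^sub>1, f\<^sub>1) \<in> V \<and> continuous_on V \<tau> \<and>
    (\<forall>v\<in>V. \<tau> v \<in> unitary_ops \<and> unitary_act (\<tau> v) (P\<^sub>1, f\<^sub>1) = v)"
proof -
  have P\<^sub>1: "P\<^sub>1 \<in> projections" "P\<^sub>1 f\<^sub>1 = f\<^sub>1" "norm f\<^sub>1 = 1"
    using b by (auto simp: proj_vec_def)
  define S where "S = direct_rotation P\<^sub>1"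
  define N where "N = proj_vec \<inter> (ball P\<^sub>1 (1/2) \<times> UNIV)"
  define V where "V = N \<inter> (\<lambda>(P, f). S P f\<^sub>1 + f) -` (- {0})"
  define \<tau> where "\<tau> = (\<lambda>(P, f). carry (S P f\<^sub>1) f o\<^sub>L S P)"
  note compose = bounded_bilinear.continuous_on[OF bounded_bilinear_blinfun_compose]
  have N: "fst v \<in> projections" "norm (fst v - P\<^sub>1) \<le> 1/2" "fst v (snd v) = snd v" "norm (snd v) = 1"
    if "v \<in> N" for v
    using that by (auto simp: N_def proj_vec_def dist_norm norm_minus_commute)
  have contS: "continuous_on N (\<lambda>v. S (fst v))"
    unfolding S_def
    by (rule continuous_on_compose2[OF continuous_on_direct_rotation[OF P\<^sub>1(1)]])
      (use N in \<open>auto intro!: continuous_intros\<close>)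
  then have contSf: "continuous_on N (\<lambda>v. S (fst v) f\<^sub>1)"
    by (rule bounded_linear.continuous_on[OF blinfun.bounded_linear_left])
  have "openin (top_of_set proj_vec) N"
    unfolding N_def by (intro openin_open_Int open_Times open_ball open_UNIV)
  moreover have "openin (top_of_set N) V"
    unfolding V_def case_prod_beta
    by (rule continuous_openin_preimage_gen) (auto intro!: continuous_intros contSf)
  ultimately have "openin (top_of_set proj_vec) V"
    using openin_trans by blast
  moreover have "(P\<^sub>1, f\<^sub>1) \<in> V"
    using b P\<^sub>1 by (auto simp: V_def N_def S_def direct_rotation_self simp flip: scaleR_2)
  moreover have norm_eq: "norm (S (fst v) f\<^sub>1) = norm (snd v)" and nz: "S (fst v) f\<^sub>1 + snd v \<noteq> 0"
    if "v \<in> V" for v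
    using that N P\<^sub>1 direct_rotation(1)[of "fst v" P\<^sub>1]
    by (auto simp: V_def S_def norm_unitary case_prod_beta)
  moreover have "continuous_on V \<tau>"
    unfolding \<tau>_def case_prod_beta
    using norm_eq nz contS contSf
    by (intro compose continuous_on_carry)
      (auto intro: continuous_on_subset continuous_intros simp: V_def)
  moreover have "\<tau> v \<in> unitary_ops \<and> unitary_act (\<tau> v) (P\<^sub>1, f\<^sub>1) = v" if v: "v \<in> V" for v
  proof -
    obtain P f where [simp]: "v = (P, f)" by (cases v)
    have P: "P \<in> projections" "norm (P - P\<^sub>1) \<le> 1/2" "P f = f" "norm f = 1"
      using v N[of v] by (auto simp: V_def)
    note rot = direct_rotation[OF P(1) P\<^sub>1(1) P(2), folded S_def]
    let ?C = "carry (S P f\<^sub>1) f"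
    have C: "?C \<in> unitary_ops" "?C (S P f\<^sub>1) = f"
      using norm_eq[OF v] nz[OF v] by (auto intro: carry_unitary carry_moves)
    have "P (S P f\<^sub>1) = (S P o\<^sub>L P\<^sub>1 o\<^sub>L adj (S P)) (S P f\<^sub>1)"
      by (simp only: rot(2))
    also have "\<dots> = S P f\<^sub>1"
      using rot(1) P\<^sub>1 by (simp add: unitaryD)
    finally have "?C o\<^sub>L P o\<^sub>L adj ?C = P"
      using C P by (intro conj_eq_of_commute carry_commutes)
    then have "unitary_act ?C (unitary_act (S P) (P\<^sub>1, f\<^sub>1)) = v"
      using C rot(2) by (simp add: unitary_act_def)
    then show ?thesis
      using C rot(1) by (simp add: \<tau>_def unitary_act_compose compose_in_unitary_ops)
  qed
  ultimately show ?thesis by blast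
qed

theorem proposition2p1:
  fixes P\<^sub>0 :: "'a::complex_hilbert_space \<Rightarrow>\<^sub>L 'a"
  assumes "P\<^sub>0 \<in> projections"
  shows "transitive_action unitary_group (proj_vec_orbit P\<^sub>0)
           (\<lambda>U. restrict (unitary_act U) (proj_vec_orbit P\<^sub>0)) \<and>
         (\<forall>f\<^sub>0. f\<^sub>0 \<in> range (blinfun_apply P\<^sub>0) \<and> norm f\<^sub>0 = 1 \<longrightarrow>
           rho (P\<^sub>0, f\<^sub>0) \<in> unitary_ops \<rightarrow> proj_vec_orbit P\<^sub>0 \<and>
           has_continuous_local_cross_sections unitary_ops (proj_vec_orbit P\<^sub>0) (rho (P\<^sub>0, f\<^sub>0)))"
proof (intro conjI allI impI)
  show "transitive_action unitary_group (proj_vec_orbit P\<^sub>0)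
      (\<lambda>U. restrict (unitary_act U) (proj_vec_orbit P\<^sub>0))"
    using orbit_transitive
    by (intro transitive_action.intro group_action_orbit transitive_action_axioms.intro)
      (fastforce simp: unitary_group_def)
next
  fix f\<^sub>0 assume f\<^sub>0: "f\<^sub>0 \<in> range (blinfun_apply P\<^sub>0) \<and> norm f\<^sub>0 = 1"
  have rho: "rho (P\<^sub>0, f\<^sub>0) U = unitary_act U (P\<^sub>0, f\<^sub>0)" for U
    by (simp add: rho_def unitary_act_def)
  have base: "(P\<^sub>0, f\<^sub>0) \<in> proj_vec_orbit P\<^sub>0"
    using f\<^sub>0 assms
    by (auto simp: proj_vec_orbit_def proj_vec_def projectionsD
        intro!: bexI[of _ id_blinfun] blinfun_eqI)
  show "rho (P\<^sub>0, f\<^sub>0) \<in> unitary_ops \<rightarrow> proj_vec_orbit P\<^sub>0"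
    using base unitary_act_in_orbit by (auto simp: rho)
  show "has_continuous_local_cross_sections unitary_ops (proj_vec_orbit P\<^sub>0) (rho (P\<^sub>0, f\<^sub>0))"
    unfolding has_continuous_local_cross_sections_def
  proof
    fix b assume b: "b \<in> proj_vec_orbit P\<^sub>0"
    obtain W where W: "W \<in> unitary_ops" "unitary_act W (P\<^sub>0, f\<^sub>0) = b"
      using orbit_transitive[OF base b] by blast
    have sub: "proj_vec_orbit P\<^sub>0 \<subseteq> proj_vec" by (auto simp: proj_vec_orbit_def)
    obtain V \<tau> where V: "openin (top_of_set proj_vec) V" "b \<in> V" "continuous_on V \<tau>"
      and \<tau>: "\<And>v. v \<in> V \<Longrightarrow> \<tau> v \<in> unitary_ops" "\<And>v. v \<in> V \<Longrightarrow> unitary_act (\<tau> v) b = v"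
      using local_section_at[of "fst b" "snd b"] b sub by auto blast
    let ?V = "proj_vec_orbit P\<^sub>0 \<inter> V" and ?\<sigma> = "\<lambda>v. \<tau> v o\<^sub>L W"
    have "openin (top_of_set (proj_vec_orbit P\<^sub>0)) ?V"
      using V(1) sub by (metis inf.absorb_iff2 openin_subtopology_Int2 subtopology_subtopology
          inf_commute)
    moreover have "continuous_on ?V ?\<sigma>"
      using V(3) by (intro bounded_bilinear.continuous_on[OF bounded_bilinear_blinfun_compose])
        (auto intro: continuous_on_subset)
    moreover have "?\<sigma> \<in> ?V \<rightarrow> unitary_ops" "\<forall>v\<in>?V. rho (P\<^sub>0, f\<^sub>0) (?\<sigma> v) = v"
      using \<tau> W by (auto simp: rho unitary_act_compose compose_in_unitary_ops)
    ultimately show "\<exists>V \<sigma>. openin (top_of_set (proj_vec_orbit P\<^sub>0)) V \<and> b \<in> V \<and>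
        continuous_on V \<sigma> \<and> \<sigma> \<in> V \<rightarrow> unitary_ops \<and> (\<forall>v\<in>V. rho (P\<^sub>0, f\<^sub>0) (\<sigma> v) = v)"
      using b V(2) by (intro exI[of _ ?V] exI[of _ ?\<sigma>]) auto
  qed
qed

end
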